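(* Let $X\ge 0$ be a random variable with distribution $F$ and Laplace--Stieltjes transform $L$, and let $n<s<n+1$, where $n\ge 0$ is an integer. Then the fractional moment $m_s={\bf E}[X^s]$ satisfies $$m_{s}=\frac{1}{\pi}\,\Gamma(s+1)\,\sin((s-n)\pi)\int_0^{\infty}\frac{{\bf E}[q_n(\lambda X)]}{\lambda^{s+1}}\,d\lambda=\frac{(-1)^{n+1}}{\Gamma(-s)}\int_0^{\infty}\frac{{\bf E}[q_n(\lambda X)]}{\lambda^{s+1}}\,d\lambda,$$ as equalities in $[0,\infty]$ (all finite and equal, or all infinite). If, in addition, $m_s<\infty$ for some $s\in(n,n+1)$ with integer $n\ge 0$, then $$m_{s}=\frac{1}{\pi}\,\Gamma(s+1)\,\sin((s-n)\pi)\int_0^{\infty}\frac{Q_n(\lambda)}{\lambda^{s+1}}\,d\lambda=\frac{(-1)^{n+1}}{\Gamma(-s)}\int_0^{\infty}\frac{Q_n(\lambda)}{\lambda^{s+1}}\,d\lambda .$$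
   Context: The Laplace--Stieltjes transform is $L(\lambda)={\bf E}[\exp(-\lambda X)]$, $\lambda\ge 0$, and $m_k={\bf E}[X^k]$. For an integer $n\ge 0$ define $$q_n(\lambda)=(-1)^{n+1}\biggl(e^{-\lambda}-\sum_{k=0}^n\frac{(-1)^k}{k!}\lambda^k\biggr),\quad\lambda\ge 0,$$ which satisfies $q_n\ge 0$ on $[0,\infty)$, so that ${\bf E}[q_n(\lambda X)]\in[0,\infty]$ is defined. Provided the moments are finite, define $$Q_n(\lambda)=(-1)^{n+1}\biggl(L(\lambda)-\sum_{k=0}^n\frac{(-1)^k}{k!}m_k\lambda^k\biggr),\quad\lambda\ge 0.$$ *)

theory Defs
  imports "HOL-Probability.Probability"
begin

definition q :: "nat \<Rightarrow> real \<Rightarrow> real" where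
  "q n x = (-1) ^ (n + 1) * (exp (- x) - (\<Sum>k = 0..n. (-1) ^ k / fact k * x ^ k))"

text \<open>By nonnegativity, the truncation in \<open>ennreal (q n x)\<close> below is harmless.\<close>

lemma q_nonneg:
  assumes "0 \<le> x"
  shows "0 \<le> q n x"
proof -
  obtain t where t: "exp (- x) = (\<Sum>k<n + 1. (- x) ^ k / fact k) + exp t / fact (n + 1) * (- x) ^ (n + 1)"
    using Maclaurin_exp_le[of "- x" "n + 1"] by blast
  have "(\<Sum>k<n + 1. (- x) ^ k / fact k) = (\<Sum>k = 0..n. (-1) ^ k / fact k * x ^ k)"
    by (rule sum.cong) (auto simp: power_minus[of x])
  with t have "q n x = (-1) ^ (n + 1) * (exp t / fact (n + 1) * (- x) ^ (n + 1))"
    by (simp add: q_def)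
  also have "\<dots> = exp t / fact (n + 1) * ((-1) * (- x)) ^ (n + 1)"
    by (simp only: power_mult_distrib mult.left_commute)
  also have "\<dots> \<ge> 0"
    using assms by simp
  finally show ?thesis .
qed

definition laplace_stieltjes :: "'a measure \<Rightarrow> ('a \<Rightarrow> real) \<Rightarrow> real \<Rightarrow> real" where
  "laplace_stieltjes M X t = (LINT \<omega>|M. exp (- t * X \<omega>))"

text \<open>Integer moments are Bochner integrals, with the junk value \<open>0\<close> if \<open>X\<^sup>k\<close> is not integrable;
  \<open>Q\<close> is meaningful only if the moments up to order \<open>n\<close> are finite.\<close>

definition moment :: "'a measure \<Rightarrow> ('a \<Rightarrow> real) \<Rightarrow> nat \<Rightarrow> real" where
  "moment M X k = (LINT \<omega>|M. X \<omega> ^ k)"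

definition Q :: "'a measure \<Rightarrow> ('a \<Rightarrow> real) \<Rightarrow> nat \<Rightarrow> real \<Rightarrow> real" where
  "Q M X n t = (-1) ^ (n + 1) *
     (laplace_stieltjes M X t - (\<Sum>k = 0..n. (-1) ^ k / fact k * moment M X k * t ^ k))"

definition frac_moment :: "'a measure \<Rightarrow> ('a \<Rightarrow> real) \<Rightarrow> real \<Rightarrow> ennreal" where
  "frac_moment M X s = (\<integral>\<^sup>+\<omega>. ennreal (X \<omega> powr s) \<partial>M)"

definition expected_q :: "'a measure \<Rightarrow> ('a \<Rightarrow> real) \<Rightarrow> nat \<Rightarrow> real \<Rightarrow> ennreal" where
  "expected_q M X n t = (\<integral>\<^sup>+\<omega>. ennreal (q n (t * X \<omega>)) \<partial>M)"

end

theory Submission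
  imports Defs
begin

text \<open>
  The theorem is the constant \<open>C = \<integral>\<^sub>0\<^sup>\<infinity> q\<^sub>n(t) t\<^sup>-\<^sup>s\<^sup>-\<^sup>1 dt\<close> plus homogeneity. For a fixed \<open>x > 0\<close>, the substitution
  \<open>t \<mapsto> t / x\<close> gives \<open>\<integral> q\<^sub>n(t x) t\<^sup>-\<^sup>s\<^sup>-\<^sup>1 dt = x\<^sup>s C\<close> (\<open>nn_integral_powr_scale\<close>), and this also holds
  for \<open>x = 0\<close>, where both sides vanish. Taking \<open>x = X \<omega>\<close>, integrating over \<open>\<omega>\<close> and exchanging the
  two integrals, which is allowed since \<open>q\<^sub>n \<ge> 0\<close>, yields \<open>m\<^sub>s C\<close> on one side and the
  integral of \<open>E[q\<^sub>n(t X)] t\<^sup>-\<^sup>s\<^sup>-\<^sup>1\<close> on the other (\<open>nn_integral_expected_q\<close>). Tonelli needs no finiteness, so the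
  identity holds in \<open>[0, \<infinity>]\<close>.

  The constant comes from \<open>q\<^sub>n' = q\<^sub>n\<^sub>-\<^sub>1\<close> and \<open>q\<^sub>n(0) = 0\<close>, with \<open>q\<^sub>-\<^sub>1(x) = e\<^sup>-\<^sup>x\<close>: an integration by parts
  (\<open>nn_integral_primitive_over_powr\<close>) lowers \<open>n\<close> and \<open>s\<close> together by one at the cost of a factor
  \<open>1 / s\<close>, down to Euler's integral for the Gamma function. The factors \<open>1 / s\<close> are exactly those of
  the functional equation of Gamma up to sign, whence \<open>C = (-1)\<^sup>n\<^sup>+\<^sup>1 \<Gamma>(-s)\<close>
  (\<open>nn_integral_q_over_powr\<close>). Euler's reflection formula turns \<open>1 / C\<close> into the expression with the
  sine (\<open>Gamma_sin_reflection\<close>), which shows in particular that \<open>C\<close> is positive.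

  If \<open>m\<^sub>s < \<infinity>\<close>, then \<open>X\<^sup>k \<le> 1 + X\<^sup>s\<close> makes the moments up to order \<open>n\<close> finite, the expectation may be taken
  term by term in \<open>q\<^sub>n(t X)\<close>, and \<open>E[q\<^sub>n(t X)] = Q\<^sub>n(t)\<close> (\<open>expectation_q_eq_Q\<close>). The real-valued
  identities are then the extended ones read off for a nonnegative integrand with finite integral.
\<close>

section \<open>Integration by parts against a negative power\<close>

text \<open>
  Writing \<open>F\<close> as the integral of \<open>f\<close> and exchanging the order of integration replaces integration by
  parts: no boundary term at \<open>0\<close> or \<open>\<infinity>\<close> has to be controlled, and either side may be infinite.
\<close>
lemma nn_integral_primitive_over_powr:
  fixes F f :: "real \<Rightarrow> real"
  assumes f [measurable]: "f \<in> borel_measurable borel"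
    and F: "\<And>x. 0 \<le> x \<Longrightarrow> (F has_real_derivative f x) (at x)"
    and f0: "\<And>x. 0 \<le> x \<Longrightarrow> 0 \<le> f x"
    and F0: "F 0 = 0" and s: "0 < s"
  shows "(\<integral>\<^sup>+t\<in>{0<..}. ennreal (F t / t powr (s + 1)) \<partial>lborel) =
    ennreal (1 / s) * (\<integral>\<^sup>+v\<in>{0<..}. ennreal (f v / v powr s) \<partial>lborel)"
proof -
  let ?D = "{p :: real \<times> real. 0 \<le> fst p \<and> fst p \<le> snd p \<and> 0 < snd p}"
  \<comment> \<open>The inner integrals of \<open>?g\<close> give the left integrand and \<open>1 / s\<close> times the right one.\<close>
  let ?g = "\<lambda>v t. ennreal (f v / t powr (s + 1)) * indicator ?D (v, t)"
  have inner_v: "(\<integral>\<^sup>+v. ?g v t \<partial>lborel) = ennreal (F t / t powr (s + 1))" if t: "0 < t" for t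
  proof -
    have "(\<integral>\<^sup>+v. ?g v t \<partial>lborel) = (\<integral>\<^sup>+v. ennreal (f v / t powr (s + 1)) * indicator {0..t} v \<partial>lborel)"
      using t by (intro nn_integral_cong) (auto simp: indicator_def)
    also have "\<dots> = ennreal (F t / t powr (s + 1) - F 0 / t powr (s + 1))"
    proof (rule nn_integral_FTC_Icc)
      fix x assume "x \<in> {0..t}"
      then show "((\<lambda>x. F x / t powr (s + 1)) has_real_derivative f x / t powr (s + 1)) (at x)"
        by (intro DERIV_cdivide F) simp
    qed (use t f0 in auto)
    finally show ?thesis by (simp add: F0)
  qed
  have inner_t: "(\<integral>\<^sup>+t. ?g v t \<partial>lborel) = ennreal (1 / s) * ennreal (f v / v powr s)" if v: "0 < v" for v
  proof -
    have "(\<integral>\<^sup>+t. ?g v t \<partial>lborel) =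
        (\<integral>\<^sup>+t. ennreal (f v * (t powr (- s - 1))) * indicator {v..} t \<partial>lborel)"
      using v by (intro nn_integral_cong) (auto simp: indicator_def powr_minus_divide[of _ "s + 1", simplified])
    also have "\<dots> = ennreal (0 - f v * (- 1 / s * v powr (- s)))"
    proof (rule nn_integral_FTC_atLeast[where F = "\<lambda>t. f v * (- 1 / s * t powr (- s))"])
      fix t assume vt: "v \<le> t"
      then show "((\<lambda>t. f v * (- 1 / s * t powr (- s))) has_real_derivative f v * t powr (- s - 1)) (at t)"
        using v s by (auto intro!: derivative_eq_intros)
      show "0 \<le> f v * t powr (- s - 1)" using v vt f0 by simp
    next
      have "((\<lambda>t::real. t powr (- s)) \<longlongrightarrow> 0) at_top"
        using s by (intro tendsto_neg_powr filterlim_ident) auto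
      then have "((\<lambda>t. f v * (- 1 / s * t powr (- s))) \<longlongrightarrow> f v * (- 1 / s * 0)) at_top"
        by (intro tendsto_intros)
      then show "((\<lambda>t. f v * (- 1 / s * t powr (- s))) \<longlongrightarrow> 0) at_top" by simp
    qed simp
    also have "0 - f v * (- 1 / s * v powr (- s)) = 1 / s * (f v / v powr s)"
      by (simp add: powr_minus_divide)
    finally show ?thesis using s by (simp only: ennreal_mult' zero_le_divide_1_iff less_imp_le)
  qed
  have "(\<integral>\<^sup>+t\<in>{0<..}. ennreal (F t / t powr (s + 1)) \<partial>lborel) = (\<integral>\<^sup>+t. (\<integral>\<^sup>+v. ?g v t \<partial>lborel) \<partial>lborel)"
    by (intro nn_integral_cong) (use inner_v in \<open>auto simp: indicator_def\<close>)
  also have "\<dots> = (\<integral>\<^sup>+v. (\<integral>\<^sup>+t. ?g v t \<partial>lborel) \<partial>lborel)"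
  proof (rule lborel_pair.Fubini')
    have "Measurable.pred (borel \<Otimes>\<^sub>M borel) (\<lambda>p :: real \<times> real. 0 \<le> fst p \<and> fst p \<le> snd p \<and> 0 < snd p)"
      by measurable
    then have [measurable]: "?D \<in> sets (borel \<Otimes>\<^sub>M borel)"
      by (simp add: pred_def space_pair_measure)
    show "(\<lambda>(v, t). ?g v t) \<in> borel_measurable (lborel \<Otimes>\<^sub>M lborel)" by measurable
  qed
  also have "\<dots> = (\<integral>\<^sup>+v. ennreal (1 / s) * (ennreal (f v / v powr s) * indicator {0<..} v) \<partial>lborel)"
  proof (rule nn_integral_cong_AE)
    \<comment> \<open>At \<open>v = 0\<close> the inner integral is that of \<open>f 0 / t powr (s + 1)\<close> over all \<open>t > 0\<close>, which diverges
      if \<open>f 0 > 0\<close>; this point has to be left out.\<close>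
    show "AE v in lborel. (\<integral>\<^sup>+t. ?g v t \<partial>lborel) =
        ennreal (1 / s) * (ennreal (f v / v powr s) * indicator {0<..} v)"
      using AE_lborel_singleton[of 0]
    proof eventually_elim
      case (elim v)
      then show ?case
        using inner_t[of v] by (cases "0 < v") (auto simp: indicator_def)
    qed
  qed
  also have "\<dots> = ennreal (1 / s) * (\<integral>\<^sup>+v\<in>{0<..}. ennreal (f v / v powr s) \<partial>lborel)"
    by (rule nn_integral_cmult) measurable
  finally show ?thesis .
qed

section \<open>The Mellin transform of the Taylor remainders of \<open>e\<^sup>-\<^sup>x\<close>\<close>

lemma borel_measurable_q [measurable]: "q n \<in> borel_measurable borel"
  unfolding q_def by measurable

lemma q_0: "q n 0 = 0"
  by (simp add: q_def sum.atLeast_Suc_atMost)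

lemma DERIV_q_0: "(q 0 has_real_derivative exp (- x)) (at x)"
  unfolding q_def by (auto intro!: derivative_eq_intros)

lemma DERIV_q_Suc: "(q (Suc n) has_real_derivative q n x) (at x)"
proof -
  have "((\<lambda>x. \<Sum>k = 0..Suc n. (-1) ^ k / fact k * x ^ k) has_real_derivative
      (\<Sum>k = 0..Suc n. (-1) ^ k / fact k * (real k * x ^ (k - 1)))) (at x)"
    by (intro DERIV_sum) (auto intro!: derivative_eq_intros)
  moreover have shift: "(-1) ^ Suc k / fact (Suc k) * (real (Suc k) * x ^ (Suc k - 1)) =
      - ((-1) ^ k / fact k * x ^ k)" for k
    by (simp add: fact_Suc del: of_nat_Suc)
  then have "(\<Sum>k = 0..Suc n. (-1) ^ k / fact k * (real k * x ^ (k - 1))) =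
      - (\<Sum>k = 0..n. (-1) ^ k / fact k * x ^ k)"
    by (simp only: sum.atLeast0_atMost_Suc_shift sum_negf[symmetric])
       (simp add: shift del: sum.cl_ivl_Suc of_nat_Suc power_Suc fact_Suc)
  ultimately have sum: "((\<lambda>x. \<Sum>k = 0..Suc n. (-1) ^ k / fact k * x ^ k) has_real_derivative
      - (\<Sum>k = 0..n. (-1) ^ k / fact k * x ^ k)) (at x)" by simp
  have "((\<lambda>x. exp (- x)) has_real_derivative - exp (- x)) (at x)"
    by (auto intro!: derivative_eq_intros)
  from DERIV_cmult[OF DERIV_diff[OF this sum], of "(-1) ^ (Suc n + 1)"]
  show ?thesis by (simp add: q_def[abs_def] algebra_simps)
qed

lemma Gamma_uminus_shift:
  fixes s :: real
  shows "Gamma (- s) = - Gamma (1 - s) / s"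
proof -
  have "rGamma (- s) = - s * rGamma (1 - s)"
    using rGamma_plus1[of "- s"] by (simp add: add.commute)
  then show ?thesis by (simp add: Gamma_def divide_inverse)
qed

text \<open>
  Since \<open>q\<^sub>n\<close> is the primitive of \<open>q\<^sub>n\<^sub>-\<^sub>1\<close> vanishing at \<open>0\<close>, both sides satisfy the same recursion, in which
  \<open>n\<close> and \<open>s\<close> drop by one. The case \<open>n = 0\<close> has the derivative \<open>e\<^sup>-\<^sup>x\<close> and leads to Euler's integral for
  \<open>\<Gamma>(1 - s)\<close>, which converges because \<open>s < 1\<close>.
\<close>
lemma nn_integral_q_over_powr:
  assumes "real n < s" "s < real n + 1"
  shows "(\<integral>\<^sup>+t\<in>{0<..}. ennreal (q n t / t powr (s + 1)) \<partial>lborel) = ennreal ((-1) ^ (n + 1) * Gamma (- s))"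
  using assms
proof (induction n arbitrary: s)
  case 0
  have "(\<integral>\<^sup>+t\<in>{0<..}. ennreal (q 0 t / t powr (s + 1)) \<partial>lborel) =
      ennreal (1 / s) * (\<integral>\<^sup>+t\<in>{0<..}. ennreal (exp (- t) / t powr s) \<partial>lborel)"
    using 0 by (intro nn_integral_primitive_over_powr DERIV_q_0 q_0) auto
  also have "(\<integral>\<^sup>+t\<in>{0<..}. ennreal (exp (- t) / t powr s) \<partial>lborel) = ennreal (Gamma (1 - s))"
    using 0 by (subst Gamma_conv_nn_integral_real)
      (auto intro!: nn_integral_cong simp: indicator_def powr_minus_divide exp_minus field_simps)
  also have "ennreal (1 / s) * ennreal (Gamma (1 - s)) = ennreal ((-1) ^ (0 + 1) * Gamma (- s))"
    using 0 Gamma_uminus_shift[of s] by (simp flip: ennreal_mult')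
  finally show ?case .
next
  case (Suc n)
  have "(\<integral>\<^sup>+t\<in>{0<..}. ennreal (q (Suc n) t / t powr (s + 1)) \<partial>lborel) =
      ennreal (1 / s) * (\<integral>\<^sup>+t\<in>{0<..}. ennreal (q n t / t powr s) \<partial>lborel)"
    using Suc.prems by (intro nn_integral_primitive_over_powr DERIV_q_Suc q_0 q_nonneg) auto
  also have "(\<integral>\<^sup>+t\<in>{0<..}. ennreal (q n t / t powr s) \<partial>lborel) = ennreal ((-1) ^ (n + 1) * Gamma (1 - s))"
    using Suc.IH[of "s - 1"] Suc.prems by simp
  also have "ennreal (1 / s) * \<dots> = ennreal ((-1) ^ (Suc n + 1) * Gamma (- s))"
    using Suc.prems Gamma_uminus_shift[of s] by (simp flip: ennreal_mult')
  finally show ?case .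
qed

lemma nn_integral_powr_scale:
  fixes h :: "real \<Rightarrow> real"
  assumes [measurable]: "h \<in> borel_measurable borel" and x: "0 < x"
  shows "(\<integral>\<^sup>+t\<in>{0<..}. ennreal (h (t * x) / t powr (s + 1)) \<partial>lborel) =
    ennreal (x powr s) * (\<integral>\<^sup>+t\<in>{0<..}. ennreal (h t / t powr (s + 1)) \<partial>lborel)"
proof -
  let ?I = "\<integral>\<^sup>+t\<in>{0<..}. ennreal (h (t * x) / t powr (s + 1)) \<partial>lborel"
  have "(\<integral>\<^sup>+t\<in>{0<..}. ennreal (h t / t powr (s + 1)) \<partial>lborel) =
     ennreal x * (\<integral>\<^sup>+t. ennreal (h (x * t) / (x * t) powr (s + 1)) * indicator {0<..} (x * t) \<partial>lborel)"
    using x by (subst nn_integral_real_affine[where c = x and t = 0]) auto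
  also have "(\<integral>\<^sup>+t. ennreal (h (x * t) / (x * t) powr (s + 1)) * indicator {0<..} (x * t) \<partial>lborel) =
      (\<integral>\<^sup>+t. ennreal (x powr - (s + 1)) * (ennreal (h (t * x) / t powr (s + 1)) * indicator {0<..} t) \<partial>lborel)"
    using x by (intro nn_integral_cong)
      (auto simp: indicator_def powr_mult powr_minus_divide[of x "s + 1", simplified]
        zero_less_mult_iff mult.commute simp flip: ennreal_mult')
  also have "\<dots> = ennreal (x powr - (s + 1)) * ?I"
    by (rule nn_integral_cmult) measurable
  finally have "ennreal (x powr s) * (\<integral>\<^sup>+t\<in>{0<..}. ennreal (h t / t powr (s + 1)) \<partial>lborel) =
      ennreal (x powr s * (x * x powr - (s + 1))) * ?I"
    using x by (simp add: ennreal_mult mult.assoc)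
  also have "x powr s * (x * x powr - (s + 1)) = 1"
    using x by (simp add: powr_diff powr_minus powr_add)
  finally show ?thesis by simp
qed

text \<open>
  The real form of Euler's reflection formula for \<open>\<Gamma>(-s) \<Gamma>(1 + s)\<close>; shifting the sine by \<open>n \<pi>\<close> accounts
  for the sign. Working with the reciprocal Gamma function covers integers \<open>s \<ge> 0\<close> too, where both
  sides are \<open>0\<close> by the convention \<open>Gamma (- s) = 0\<close> at a pole.
\<close>
lemma Gamma_sin_reflection:
  fixes s :: real
  assumes s: "- 1 < s"
  shows "1 / pi * Gamma (s + 1) * sin ((s - real n) * pi) = (-1) ^ (n + 1) / Gamma (- s)"
proof -
  have "complex_of_real (rGamma (- s) * rGamma (1 + s)) = of_real (sin (pi * (- s)) / pi)"
    using rGamma_reflection_complex[of "of_real (- s)"]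
    unfolding of_real_mult of_real_divide rGamma_complex_of_real[symmetric] sin_of_real[symmetric]
    by simp
  then have "sin (pi * s) = - pi * (rGamma (- s) * rGamma (1 + s))"
    by (simp only: of_real_eq_iff) simp
  moreover have "sin ((s - real n) * pi) = (-1) ^ n * sin (pi * s)"
    by (simp add: left_diff_distrib sin_diff mult.commute[of s])
  moreover have "rGamma (1 + s) * Gamma (s + 1) = 1"
    using s Gamma_real_pos[of "s + 1"] by (simp add: Gamma_def add.commute)
  ultimately have "1 / pi * Gamma (s + 1) * sin ((s - real n) * pi) = (-1) ^ (n + 1) * rGamma (- s)"
    by (simp add: mult.commute[of "Gamma (s + 1)"])
  then show ?thesis by (simp add: Gamma_def divide_inverse)
qed

section \<open>Fractional moments\<close>

lemma nn_integral_expected_q: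
  assumes "sigma_finite_measure M"
    and [measurable]: "X \<in> borel_measurable M"
    and X0: "AE \<omega> in M. 0 \<le> X \<omega>"
    and s: "real n < s" "s < real n + 1"
  shows "(\<integral>\<^sup>+t\<in>{0<..}. (expected_q M X n t / ennreal (t powr (s + 1))) \<partial>lborel) =
    frac_moment M X s * ennreal ((-1) ^ (n + 1) * Gamma (- s))"
proof -
  interpret sigma_finite_measure M by fact
  interpret pair_sigma_finite M lborel ..
  let ?g = "\<lambda>\<omega> t. ennreal (q n (t * X \<omega>)) / ennreal (t powr (s + 1)) * indicator {0<..} t"
  have "(\<integral>\<^sup>+t\<in>{0<..}. (expected_q M X n t / ennreal (t powr (s + 1))) \<partial>lborel) =
      (\<integral>\<^sup>+t. (\<integral>\<^sup>+\<omega>. ?g \<omega> t \<partial>M) \<partial>lborel)"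
    unfolding expected_q_def by (simp add: nn_integral_multc nn_integral_divide)
  also have "\<dots> = (\<integral>\<^sup>+\<omega>. (\<integral>\<^sup>+t. ?g \<omega> t \<partial>lborel) \<partial>M)"
    by (rule Fubini') measurable
  also have "\<dots> = (\<integral>\<^sup>+\<omega>. ennreal (X \<omega> powr s) * ennreal ((-1) ^ (n + 1) * Gamma (- s)) \<partial>M)"
  proof (rule nn_integral_cong_AE)
    show "AE \<omega> in M. (\<integral>\<^sup>+t. ?g \<omega> t \<partial>lborel) =
        ennreal (X \<omega> powr s) * ennreal ((-1) ^ (n + 1) * Gamma (- s))"
      using X0
    proof eventually_elim
      case (elim \<omega>)
      have "(\<integral>\<^sup>+t. ?g \<omega> t \<partial>lborel) =
          (\<integral>\<^sup>+t\<in>{0<..}. ennreal (q n (t * X \<omega>) / t powr (s + 1)) \<partial>lborel)"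
        using elim by (intro nn_integral_cong) (auto simp: indicator_def divide_ennreal q_nonneg)
      also have "\<dots> = ennreal (X \<omega> powr s) * ennreal ((-1) ^ (n + 1) * Gamma (- s))"
      proof (cases "X \<omega> = 0")
        case True
        then show ?thesis by (simp add: q_0)
      next
        case False
        with elim show ?thesis
          by (simp only: nn_integral_powr_scale borel_measurable_q nn_integral_q_over_powr[OF s])
      qed
      finally show ?case .
    qed
  qed
  also have "\<dots> = frac_moment M X s * ennreal ((-1) ^ (n + 1) * Gamma (- s))"
    unfolding frac_moment_def by (rule nn_integral_multc) measurable
  finally show ?thesis .
qed

section \<open>Finite fractional moments and the Laplace transform\<close>

lemma (in finite_measure) integrable_power_if_frac_moment_finite:
  assumes [measurable]: "X \<in> borel_measurable M"
    and X0: "AE \<omega> in M. 0 \<le> X \<omega>"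
    and fin: "frac_moment M X s < \<infinity>" and k: "real k \<le> s"
  shows "integrable M (\<lambda>\<omega>. X \<omega> ^ k)"
proof -
  have "integrable M (\<lambda>\<omega>. X \<omega> powr s)"
    using fin unfolding frac_moment_def by (intro integrableI_nonneg) auto
  then have "integrable M (\<lambda>\<omega>. 1 + X \<omega> powr s)" by simp
  then show ?thesis
  proof (rule Bochner_Integration.integrable_bound)
    show "AE \<omega> in M. norm (X \<omega> ^ k) \<le> norm (1 + X \<omega> powr s)"
      using X0
    proof eventually_elim
      case (elim \<omega>)
      have "X \<omega> ^ k \<le> 1 + X \<omega> powr s"
      proof (cases "X \<omega> \<le> 1")
        case True
        then have "X \<omega> ^ k \<le> 1" using elim by (simp add: power_le_one)
        then show ?thesis by (smt (verit) powr_ge_zero)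
      next
        case False
        then have "X \<omega> ^ k = X \<omega> powr real k" by (simp add: powr_realpow)
        also have "\<dots> \<le> X \<omega> powr s" using False k by (intro powr_mono) auto
        finally show ?thesis by simp
      qed
      then show ?case using elim by simp
    qed
  qed measurable
qed

lemma (in finite_measure) expectation_q_eq_Q:
  assumes [measurable]: "X \<in> borel_measurable M"
    and X0: "AE \<omega> in M. 0 \<le> X \<omega>" and t: "0 \<le> t"
    and mom: "\<forall>k\<le>n. integrable M (\<lambda>\<omega>. X \<omega> ^ k)"
  shows "expected_q M X n t = ennreal (Q M X n t)" and "0 \<le> Q M X n t"
proof -
  have "AE \<omega> in M. norm (exp (- (t * X \<omega>))) \<le> 1"
    using X0 by eventually_elim (use t in simp)
  then have int_exp: "integrable M (\<lambda>\<omega>. exp (- (t * X \<omega>)))"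
    by (intro integrable_const_bound[where B = 1]) auto
  have int_poly: "integrable M (\<lambda>\<omega>. (-1) ^ k / fact k * (t * X \<omega>) ^ k)" if "k \<in> {0..n}" for k
    using mom that by (simp add: power_mult_distrib)
  have int_q: "integrable M (\<lambda>\<omega>. q n (t * X \<omega>))"
    unfolding q_def using int_exp int_poly
    by (intro integrable_mult_right[OF Bochner_Integration.integrable_diff]
      Bochner_Integration.integrable_sum)
  have q0: "AE \<omega> in M. 0 \<le> q n (t * X \<omega>)"
    using X0 by eventually_elim (use t in \<open>simp add: q_nonneg\<close>)
  have "(LINT \<omega>|M. q n (t * X \<omega>)) = (-1) ^ (n + 1) * ((LINT \<omega>|M. exp (- (t * X \<omega>))) -
      (\<Sum>k = 0..n. LINT \<omega>|M. (-1) ^ k / fact k * (t * X \<omega>) ^ k))"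
    unfolding q_def integral_mult_right_zero using int_exp int_poly
    by (simp only: Bochner_Integration.integral_diff Bochner_Integration.integral_sum
      Bochner_Integration.integrable_sum integral_mult_right_zero)
  also have "(\<Sum>k = 0..n. LINT \<omega>|M. (-1) ^ k / fact k * (t * X \<omega>) ^ k) =
      (\<Sum>k = 0..n. (-1) ^ k / fact k * moment M X k * t ^ k)"
    unfolding moment_def by (simp add: power_mult_distrib mult_ac)
  finally have Q: "(LINT \<omega>|M. q n (t * X \<omega>)) = Q M X n t"
    by (simp add: Q_def laplace_stieltjes_def)
  show "expected_q M X n t = ennreal (Q M X n t)"
    unfolding expected_q_def Q[symmetric] by (rule nn_integral_eq_integral[OF int_q q0])
  show "0 \<le> Q M X n t"
    unfolding Q[symmetric] by (rule integral_nonneg_AE[OF q0])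
qed

lemma set_integral_eq_enn2real:
  fixes f :: "'a \<Rightarrow> real"
  assumes [measurable]: "f \<in> borel_measurable M" "A \<in> sets M"
    and f0: "\<And>x. x \<in> A \<Longrightarrow> 0 \<le> f x" and fin: "(\<integral>\<^sup>+x\<in>A. ennreal (f x) \<partial>M) < \<infinity>"
  shows "set_integrable M A f"
    and "(LINT x:A|M. f x) = enn2real (\<integral>\<^sup>+x\<in>A. ennreal (f x) \<partial>M)"
proof -
  have eq: "(\<integral>\<^sup>+x. ennreal (indicator A x *\<^sub>R f x) \<partial>M) = (\<integral>\<^sup>+x\<in>A. ennreal (f x) \<partial>M)"
    by (intro nn_integral_cong) (auto simp: indicator_def)
  show "set_integrable M A f"
    unfolding set_integrable_def using f0 fin
    by (intro integrableI_nonneg) (simp_all only: eq infinity_ennreal_def, auto simp: indicator_def)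
  show "(LINT x:A|M. f x) = enn2real (\<integral>\<^sup>+x\<in>A. ennreal (f x) \<partial>M)"
    unfolding set_lebesgue_integral_def eq[symmetric] using f0
    by (intro integral_eq_nn_integral) (auto simp: indicator_def)
qed

theorem theorem5:
  fixes M :: "'a measure" and X :: "'a \<Rightarrow> real" and n :: nat and s :: real
  assumes "prob_space M"
    and "X \<in> borel_measurable M"
    and "AE \<omega> in M. 0 \<le> X \<omega>"
    and "real n < s" and "s < real n + 1"
  shows
    "frac_moment M X s =
        ennreal (1 / pi * Gamma (s + 1) * sin ((s - real n) * pi)) *
          (\<integral>\<^sup>+t\<in>{0<..}. (expected_q M X n t / ennreal (t powr (s + 1))) \<partial>lborel)
     \<and> frac_moment M X s =
        ennreal ((-1) ^ (n + 1) / Gamma (- s)) *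
          (\<integral>\<^sup>+t\<in>{0<..}. (expected_q M X n t / ennreal (t powr (s + 1))) \<partial>lborel)
     \<and> (frac_moment M X s < \<infinity> \<longrightarrow>
          (\<forall>k\<le>n. integrable M (\<lambda>\<omega>. X \<omega> ^ k))
        \<and> set_integrable lborel {0<..} (\<lambda>t. Q M X n t / t powr (s + 1))
        \<and> enn2real (frac_moment M X s) =
            1 / pi * Gamma (s + 1) * sin ((s - real n) * pi) *
              (LINT t:{0<..}|lborel. Q M X n t / t powr (s + 1))
        \<and> enn2real (frac_moment M X s) =
            (-1) ^ (n + 1) / Gamma (- s) *
              (LINT t:{0<..}|lborel. Q M X n t / t powr (s + 1)))"
proof -
  interpret prob_space M by fact
  note [measurable] = assms(2)
  \<comment> \<open>The reciprocal of the integral of \<open>q n t / t powr (s + 1)\<close>, so that \<open>m\<^sub>s\<close> is \<open>c\<close> times \<open>?J\<close>.\<close>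
  define c where "c = (-1) ^ (n + 1) / Gamma (- s)"
  let ?J = "\<integral>\<^sup>+t\<in>{0<..}. (expected_q M X n t / ennreal (t powr (s + 1))) \<partial>lborel"
  have c: "1 / pi * Gamma (s + 1) * sin ((s - real n) * pi) = c"
    unfolding c_def using assms(4) by (intro Gamma_sin_reflection) simp
  \<comment> \<open>The sign of \<open>c\<close> is visible in the sine form, as \<open>0 < (s - n) \<pi> < \<pi>\<close>.\<close>
  have "0 < sin ((s - real n) * pi)"
    using assms(4,5) by (intro sin_gt_zero) auto
  then have c0: "0 < c"
    using assms(4) unfolding c[symmetric] by (simp add: Gamma_real_pos)
  have "ennreal c * ?J = frac_moment M X s * ennreal (c * ((-1) ^ (n + 1) * Gamma (- s)))"
    using nn_integral_expected_q[OF sigma_finite_measure_axioms assms(2-5)] c0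
    by (simp only: ennreal_mult'[of c] mult.left_commute less_imp_le)
  also have "c * ((-1) ^ (n + 1) * Gamma (- s)) = 1"
    using c0 by (auto simp: c_def field_simps simp flip: power_mult_distrib)
  finally have J: "frac_moment M X s = ennreal c * ?J" by simp
  moreover
  {
    assume fin: "frac_moment M X s < \<infinity>"
    have mom: "\<forall>k\<le>n. integrable M (\<lambda>\<omega>. X \<omega> ^ k)"
      using assms(4) by (auto intro!: integrable_power_if_frac_moment_finite[OF assms(2,3) fin])
    note Q = expectation_q_eq_Q[OF assms(2,3) _ mom]
    let ?f = "\<lambda>t. Q M X n t / t powr (s + 1)"
    have J_Q: "?J = (\<integral>\<^sup>+t\<in>{0<..}. ennreal (?f t) \<partial>lborel)"
      by (intro nn_integral_cong) (auto simp: indicator_def Q divide_ennreal)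
    have "?J < \<infinity>"
      using fin c0 unfolding J by (auto simp: ennreal_mult_less_top)
    have [measurable]: "Q M X n \<in> borel_measurable borel"
      unfolding Q_def laplace_stieltjes_def by measurable
    have "set_integrable lborel {0<..} ?f" and L: "(LINT t:{0<..}|lborel. ?f t) = enn2real ?J"
      using set_integral_eq_enn2real[of ?f lborel "{0<..}"] \<open>?J < \<infinity>\<close> Q unfolding J_Q by auto
    moreover have "enn2real (frac_moment M X s) = c * enn2real ?J"
      using c0 unfolding J by (simp add: enn2real_mult)
    ultimately have "(\<forall>k\<le>n. integrable M (\<lambda>\<omega>. X \<omega> ^ k)) \<and> set_integrable lborel {0<..} ?f \<and>
        enn2real (frac_moment M X s) = c * (LINT t:{0<..}|lborel. ?f t)"
      using mom by simp
  }
  ultimately show ?thesis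
    unfolding c c_def[symmetric] by blast
qed

end
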